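(* Let $\lambda$ be a nonzero real number and $r\in\mathbb{Z}$. For every integer $n\ge 0$, $$B_{n,\lambda}^{(r)}(x)=\sum_{j=0}^{n}\Big\{\sum_{l=j}^{n}\binom{n}{l}S_{1,\lambda}(l,j)\,B_{n-l,\lambda}^{(r)}\Big\}\phi_{j,\lambda}(x).$$
   Context: For $\lambda\neq 0$: $(x)_{0,\lambda}=1$ and $(x)_{n,\lambda}=x(x-\lambda)\cdots(x-(n-1)\lambda)$ for $n\ge1$. The degenerate exponential is $e_\lambda^{x}(t)=\sum_{k\ge0}(x)_{k,\lambda}\frac{t^k}{k!}=(1+\lambda t)^{x/\lambda}$, $e_\lambda(t)=e_\lambda^1(t)$, and $\log_\lambda(1+t)=\frac{1}{\lambda}\big((1+t)^\lambda-1\big)$ is the compositional inverse of $e_\lambda(t)$. The degenerate Stirling numbers of the first kind are defined by $\frac{1}{k!}(\log_\lambda(1+t))^k=\sum_{n\ge k}S_{1,\lambda}(n,k)\frac{t^n}{n!}$. For $r\in\mathbb{Z}$ the degenerate polyexponential function is $\mathrm{Ei}_{r,\lambda}(x)=\sum_{n\ge1}\frac{(1)_{n,\lambda}}{(n-1)!\,n^{r}}x^n$, and the degenerate poly-Bell polynomials are defined by $\frac{\mathrm{Ei}_{r,\lambda}(\log_\lambda(1+t))}{e_\lambda(t)-1}e_\lambda^{x}(t)=\sum_{n\ge0}B_{n,\lambda}^{(r)}(x)\frac{t^n}{n!}$, with $B^{(r)}_{n,\lambda}=B^{(r)}_{n,\lambda}(0)$. The fully degenerate Bell polynomials $\phi_{n,\lambda}(x)$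 are defined by $e_\lambda^{x}\big(e_\lambda(t)-1\big)=\sum_{n\ge0}\phi_{n,\lambda}(x)\frac{t^n}{n!}$. *)

theory Defs
  imports Complex_Main "HOL-Computational_Algebra.Formal_Power_Series"
begin

text \<open>
  All generating functions are formal power series in \<open>t\<close> with real coefficients, for fixed
  real values of \<open>\<lambda>\<close> (written \<open>lam\<close>) and \<open>x\<close>.
\<close>

definition deg_falling :: "real \<Rightarrow> real \<Rightarrow> nat \<Rightarrow> real" where
  "deg_falling lam x n = (\<Prod>i<n. x - real i * lam)"

definition deg_exp :: "real \<Rightarrow> real \<Rightarrow> real fps" where
  "deg_exp lam x = Abs_fps (\<lambda>k. deg_falling lam x k / fact k)"

text \<open>\<^term>\<open>fps_binomial lam\<close> is the binomial series \<open>(1 + t)\<^sup>\<lambda>\<close>, so this is the series of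
  \<open>log\<^sub>\<lambda> (1 + t)\<close>.\<close>
definition deg_log :: "real \<Rightarrow> real fps" where
  "deg_log lam = fps_const (1 / lam) * (fps_binomial lam - 1)"

definition deg_stirling1 :: "real \<Rightarrow> nat \<Rightarrow> nat \<Rightarrow> real" where
  "deg_stirling1 lam n k = fact n * fps_nth (fps_const (1 / fact k) * deg_log lam ^ k) n"

definition deg_polyexp :: "int \<Rightarrow> real \<Rightarrow> real fps" where
  "deg_polyexp r lam =
     Abs_fps (\<lambda>n. if n = 0 then 0
                  else deg_falling lam 1 n / (fact (n - 1) * real n powi r))"

text \<open>
  The denominator below has zero constant term, so it is not invertible; the quotient is the
  library's power series division, which is exact here by \<open>deg_poly_bell_quotient\<close>.
\<close>
definition deg_poly_bell :: "int \<Rightarrow> real \<Rightarrow> nat \<Rightarrow> real \<Rightarrow> real" where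
  "deg_poly_bell r lam n x =
     fact n * fps_nth ((deg_polyexp r lam oo deg_log lam) / (deg_exp lam 1 - 1) * deg_exp lam x) n"

definition deg_bell :: "real \<Rightarrow> nat \<Rightarrow> real \<Rightarrow> real" where
  "deg_bell lam n x = fact n * fps_nth (deg_exp lam x oo (deg_exp lam 1 - 1)) n"

text \<open>
  The inner series of both compositions have zero constant term, as required for
  \<^const>\<open>fps_compose\<close> to be substitution.
\<close>
lemma deg_log_nth_0: "fps_nth (deg_log lam) 0 = 0"
  by (simp add: deg_log_def)

lemma deg_exp_minus_1_nth_0: "fps_nth (deg_exp lam x - 1) 0 = 0"
  by (simp add: deg_exp_def deg_falling_def)

lemma deg_exp_eq_binomial:
  assumes "lam \<noteq> 0"
  shows "deg_exp lam x = fps_binomial (x / lam) oo (fps_const lam * fps_X)"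
proof (rule fps_ext)
  fix n
  have "(\<Prod>i<n. x - real i * lam) = (\<Prod>i<n. lam * (x / lam - real i))"
    using assms by (intro prod.cong) (auto simp: field_simps)
  also have "\<dots> = lam ^ n * (\<Prod>i<n. x / lam - real i)"
    by (simp add: prod.distrib)
  finally show "fps_nth (deg_exp lam x) n =
      fps_nth (fps_binomial (x / lam) oo (fps_const lam * fps_X)) n"
    by (simp add: deg_exp_def deg_falling_def fps_compose_linear gbinomial_prod_rev
        atLeast0LessThan)
qed

lemma deg_poly_bell_quotient:
  "(deg_polyexp r lam oo deg_log lam) / (deg_exp lam 1 - 1) * (deg_exp lam 1 - 1)
     = deg_polyexp r lam oo deg_log lam"
proof -
  have nz: "fps_nth (deg_exp lam 1 - 1) 1 \<noteq> 0"
    by (simp add: deg_exp_def deg_falling_def)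
  then have s: "subdegree (deg_exp lam 1 - 1) = 1"
    by (intro subdegreeI) (auto simp: deg_exp_minus_1_nth_0 simp del: fps_sub_nth)
  have z: "fps_nth (deg_polyexp r lam oo deg_log lam) 0 = 0"
    by (simp add: deg_polyexp_def)
  show ?thesis
  proof (cases "deg_polyexp r lam oo deg_log lam = 0")
    case False
    with z have "subdegree (deg_polyexp r lam oo deg_log lam) \<ge> 1"
      by (intro subdegree_geI) auto
    with s nz False have "deg_exp lam 1 - 1 dvd deg_polyexp r lam oo deg_log lam"
      by (subst fps_dvd_iff) auto
    then show ?thesis by simp
  qed simp
qed

end

theory Submission
  imports Defs
begin

text \<open>
  Since \<open>log\<^sub>\<lambda> (1 + t)\<close> inverts \<open>e\<^sub>\<lambda>(t) - 1\<close>, substituting it into the generating function of the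
  \<open>\<phi>\<^bsub>j,\<lambda>\<^esub>(x)\<close> expands \<open>e\<^sub>\<lambda>\<^sup>x(t)\<close> in the powers of \<open>log\<^sub>\<lambda> (1 + t)\<close>, that is, in terms of the
  Stirling numbers. Multiplying by the generating function of the \<open>B\<^bsub>n,\<lambda>\<^esub>\<close> at \<open>x = 0\<close> and
  comparing coefficients gives the identity.
\<close>

text \<open>The differential equation of \<open>(1 + t)^c\<close>, cleared of its denominator so
  that it passes through \<open>oo\<close> by distributivity over sums and products.\<close>

lemma fps_binomial_deriv_mult:
  fixes c :: "'a::field_char_0"
  shows "(1 + fps_X) * fps_deriv (fps_binomial c) = fps_const c * fps_binomial c"
proof -
  have "fps_nth (1 + fps_X :: 'a fps) 0 \<noteq> 0" by simp
  then have "(1 + fps_X :: 'a fps) * inverse (1 + fps_X) = 1"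
    by (rule inverse_mult_eq_1')
  then show ?thesis
    by (simp add: fps_binomial_deriv fps_divide_unit mult.left_commute[of "1 + fps_X"])
qed

text \<open>Formal counterpart of \<open>((1 + t)^b)^a = (1 + t)^(a * b)\<close>: by the chain rule
  the composite solves the differential equation of exponent \<open>a * b\<close>, and its constant
  term is 1, which determines it.\<close>

lemma fps_binomial_compose_binomial:
  fixes a b :: "'a::field_char_0"
  shows "fps_binomial a oo (fps_binomial b - 1) = fps_binomial (a * b)"
proof -
  define u where "u = fps_binomial b - 1"
  define F where "F = fps_binomial a oo u"
  define G where "G = fps_deriv (fps_binomial a) oo u"
  have u0: "fps_nth u 0 = 0" by (simp add: u_def)
  have F': "fps_deriv F = G * fps_deriv u"
    by (simp add: F_def G_def fps_compose_deriv[OF u0])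
  have "((1 + fps_X) * fps_deriv (fps_binomial a)) oo u = (fps_const a * fps_binomial a) oo u"
    by (simp only: fps_binomial_deriv_mult)
  then have G: "(1 + u) * G = fps_const a * F"
    by (simp add: fps_compose_mult_distrib[OF u0] fps_compose_add_distrib F_def G_def u0)
  \<comment> \<open>The equation for exponent \<open>b\<close>, since \<open>1 + u\<close> is
    \<open>fps_binomial b\<close> and the constant 1 has zero derivative. The factor
    \<open>1 + u\<close> produced here is the one that \<open>G\<close> absorbs.\<close>
  have u': "(1 + fps_X) * fps_deriv u = fps_const b * (1 + u)"
    using fps_binomial_deriv_mult[of b] by (simp add: u_def)
  have "(1 + fps_X) * fps_deriv F = G * ((1 + fps_X) * fps_deriv u)"
    by (simp add: F' mult_ac)
  also have "\<dots> = fps_const b * ((1 + u) * G)"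
    unfolding u' by (simp only: mult_ac)
  also have "\<dots> = fps_const (a * b) * F"
    by (simp only: G mult.assoc[symmetric] fps_const_mult mult.commute[of b])
  finally have "fps_const (a * b) * F = fps_deriv F * (1 + fps_X)"
    by (simp add: mult.commute)
  moreover have "(1 + fps_X :: 'a fps) \<noteq> 0"
    by (metis add.right_neutral fps_X_nth fps_add_nth fps_one_nth fps_zero_nth zero_neq_one)
  ultimately have "fps_deriv F = fps_const (a * b) * F / (1 + fps_X)"
    by simp
  moreover have "fps_nth F 0 = 1" by (simp add: F_def)
  ultimately show ?thesis
    using fps_binomial_ODE_unique'[of F "a * b"] by (simp add: F_def u_def)
qed

text \<open>Substituting \<open>lam * deg_log lam = (1 + t)^lam - 1\<close> into
  \<open>(1 + lam * t)^(x / lam)\<close> leaves \<open>((1 + t)^lam)^(x / lam)\<close>.\<close>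

lemma deg_exp_compose_deg_log:
  assumes "lam \<noteq> 0"
  shows "deg_exp lam x oo deg_log lam = fps_binomial x"
proof -
  have "deg_exp lam x oo deg_log lam =
      fps_binomial (x / lam) oo ((fps_const lam * fps_X) oo deg_log lam)"
    unfolding deg_exp_eq_binomial[OF assms]
    by (rule fps_compose_assoc[symmetric]) (simp_all add: deg_log_nth_0)
  also have "(fps_const lam * fps_X) oo deg_log lam = fps_const lam * deg_log lam"
    by (simp add: fps_compose_mult_distrib[OF deg_log_nth_0] deg_log_nth_0)
  also have "\<dots> = fps_binomial lam - 1"
    using assms by (simp add: deg_log_def mult.assoc[symmetric])
  finally show ?thesis
    using assms by (simp add: fps_binomial_compose_binomial)
qed

lemma deg_exp_minus_1_compose_deg_log:
  assumes "lam \<noteq> 0"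
  shows "(deg_exp lam 1 - 1) oo deg_log lam = fps_X"
  using assms by (simp add: fps_compose_sub_distrib deg_exp_compose_deg_log fps_binomial_1)

lemma deg_stirling1_eq_0: "l < j \<Longrightarrow> deg_stirling1 lam l j = 0"
  by (simp add: deg_stirling1_def deg_log_nth_0 startsby_zero_power_prefix)

text \<open>Writing \<open>t\<close> as \<open>deg_exp lam 1 - 1\<close> composed with
  \<open>deg_log lam\<close> and reassociating makes the \<open>deg_bell\<close> numbers the
  coefficients of an expansion in powers of \<open>deg_log lam\<close>.\<close>

lemma deg_exp_nth_stirling:
  assumes "lam \<noteq> 0"
  shows "fact l * fps_nth (deg_exp lam x) l =
    (\<Sum>j=0..l. deg_stirling1 lam l j * deg_bell lam j x)"
proof -
  have "deg_exp lam x = deg_exp lam x oo ((deg_exp lam 1 - 1) oo deg_log lam)"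
    by (simp add: deg_exp_minus_1_compose_deg_log[OF assms])
  also have "\<dots> = (deg_exp lam x oo (deg_exp lam 1 - 1)) oo deg_log lam"
    by (rule fps_compose_assoc[OF deg_log_nth_0 deg_exp_minus_1_nth_0])
  finally have "fps_nth (deg_exp lam x) l =
      (\<Sum>j=0..l. fps_nth (deg_exp lam x oo (deg_exp lam 1 - 1)) j * fps_nth (deg_log lam ^ j) l)"
    by (metis fps_compose_nth)
  then show ?thesis
    by (simp add: deg_stirling1_def deg_bell_def sum_distrib_left mult_ac)
qed

lemma deg_exp_0: "deg_exp lam 0 = 1"
  by (rule fps_ext) (auto simp: deg_exp_def deg_falling_def intro!: prod_zero bexI[of _ 0])

text \<open>Product rule for exponential generating functions. The quotient \<open>Q\<close>
  generates the values at 0 because \<open>deg_exp lam 0 = 1\<close>.\<close>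

lemma deg_poly_bell_binomial:
  "deg_poly_bell r lam n x =
    (\<Sum>l=0..n. real (n choose l) * deg_poly_bell r lam (n - l) 0 * (fact l * fps_nth (deg_exp lam x) l))"
proof -
  define Q where "Q = (deg_polyexp r lam oo deg_log lam) / (deg_exp lam 1 - 1)"
  have "deg_poly_bell r lam n x = fact n * fps_nth (deg_exp lam x * Q) n"
    by (simp add: deg_poly_bell_def Q_def mult.commute)
  also have "\<dots> = (\<Sum>l=0..n. fact n * (fps_nth (deg_exp lam x) l * fps_nth Q (n - l)))"
    by (simp only: fps_mult_nth sum_distrib_left)
  also have "\<dots> = (\<Sum>l=0..n. real (n choose l) * (fact (n - l) * fps_nth Q (n - l))
      * (fact l * fps_nth (deg_exp lam x) l))"
    by (intro sum.cong) (auto simp: binomial_fact)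
  finally show ?thesis
    by (simp add: deg_poly_bell_def Q_def deg_exp_0)
qed

theorem theorem7:
  fixes lam x :: real and r :: int and n :: nat
  assumes "lam \<noteq> 0"
  shows "deg_poly_bell r lam n x =
    (\<Sum>j=0..n. (\<Sum>l=j..n. real (n choose l) * deg_stirling1 lam l j * deg_poly_bell r lam (n - l) 0)
       * deg_bell lam j x)"
proof -
  let ?f = "\<lambda>l j. real (n choose l) * deg_stirling1 lam l j * deg_poly_bell r lam (n - l) 0
    * deg_bell lam j x"
  have "deg_poly_bell r lam n x = (\<Sum>l=0..n. \<Sum>j=0..l. ?f l j)"
    by (subst deg_poly_bell_binomial)
      (simp add: deg_exp_nth_stirling[OF assms] sum_distrib_left mult_ac)
  \<comment> \<open>The triangle \<open>j \<le> l\<close> is padded to a square with terms that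
    vanish, \<open>deg_log lam ^ j\<close> having no term of degree below \<open>j\<close>; after
    the swap they are dropped again.\<close>
  also have "\<dots> = (\<Sum>l=0..n. \<Sum>j=0..n. ?f l j)"
    by (intro sum.cong refl sum.mono_neutral_left) (auto simp: deg_stirling1_eq_0)
  also have "\<dots> = (\<Sum>j=0..n. \<Sum>l=0..n. ?f l j)"
    by (rule sum.swap)
  also have "\<dots> = (\<Sum>j=0..n. \<Sum>l=j..n. ?f l j)"
    by (intro sum.cong refl sum.mono_neutral_right) (auto simp: deg_stirling1_eq_0)
  finally show ?thesis
    by (simp add: sum_distrib_right)
qed

end
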